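(* Let $T$ be a finite nonabelian simple group, and let $\{a,b\}$ be a generating set for $T$ such that no automorphism of $T$ interchanges $a$ and $b$. Let $N=T\times T$, $S_0=\{(a,b),(b,a)\}$, $S=S_0\cup S_0^{-1}$, and $\Gamma=\mathrm{Cay}(N,S)$. Let $\tau\in\mathrm{Aut}(N)$ be the map $\tau:(x,y)\mapsto(y,x)$, and let $G=N\rtimes\langle\tau\rangle$, where $N$ acts on the vertex set $N$ by right multiplication and $\tau$ acts naturally as an automorphism of $N$. Then $(\Gamma,G)$ lies in $\mathcal{OG}(4)$ and is basic of quasiprimitive type.
   Context: All graphs are finite, simple and undirected. For a group $N$ and an inverse-closed subset $S\subseteq N\setminus\{1_N\}$, the Cayley graph $\mathrm{Cay}(N,S)$ has vertex set $N$ and edges the pairs $\{x,y\}$ with $xy^{-1}\in S$. When $S=S_0\cup S_0^{-1}$ with $S_0\cap S_0^{-1}=\emptyset$, each edge $\{x,y\}$ is oriented $x\to y$ if and only if $yx^{-1}\in S_0$. $\mathcal{OG}(4)$ is the set of pairs $(\Gamma,G)$ where $\Gamma$ is a connected graph of valency $4$ with vertex set $X$, and $G\leq\mathrm{Aut}(\Gamma)$ is transitive on $X$ and on edges, and $\Gamma$ is $G$-oriented: there is a $G$-orbit $\Delta\subset X\times X$, disjoint from $\Delta^*=\{(y,x)\mid (x,y)\in\Delta\}$, such that the edges of $\Gamma$ are exactly the pairs $\{x,y\}$ with $(x,y)\in\Delta$ or $(y,x)\in\Delta$. A pair $(\Gamma,G)\in\mathcal{OG}(4)$ is basic of quasiprimitive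 type if $G$ is quasiprimitive on $X$, that is, every nontrivial normal subgroup of $G$ is transitive on $X$. *)

theory Defs
  imports
    "Graph_Theory.Pair_Digraph"
    "Graph_Theory.Digraph_Component"
    "HOL-Algebra.SimpleGroups"
    "HOL-Algebra.Group_Action"
    "HOL-Algebra.Generated_Groups"
begin

text \<open>
  A finite simple undirected graph is a \<open>pair_graph\<close>, i.e. a finite symmetric loop-free
  set of arcs: the undirected edge \<open>{x, y}\<close> is the pair of arcs \<open>(x, y)\<close>, \<open>(y, x)\<close>, and
  the valency of a vertex is its out-degree.
\<close>

definition edges :: "'v pair_pre_digraph \<Rightarrow> 'v set set" where
  "edges \<Gamma> = {{x, y} | x y. (x, y) \<in> parcs \<Gamma>}"

definition graph_auto :: "'v pair_pre_digraph \<Rightarrow> ('v \<Rightarrow> 'v) set" where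
  "graph_auto \<Gamma> = {f \<in> Bij (pverts \<Gamma>).
     \<forall>x\<in>pverts \<Gamma>. \<forall>y\<in>pverts \<Gamma>. (f x, f y) \<in> parcs \<Gamma> \<longleftrightarrow> (x, y) \<in> parcs \<Gamma>}"

definition graph_AutoGroup :: "'v pair_pre_digraph \<Rightarrow> ('v \<Rightarrow> 'v) monoid" where
  "graph_AutoGroup \<Gamma> = BijGroup (pverts \<Gamma>) \<lparr>carrier := graph_auto \<Gamma>\<rparr>"

definition cayley_graph :: "('a, 'm) monoid_scheme \<Rightarrow> 'a set \<Rightarrow> 'a pair_pre_digraph" where
  "cayley_graph N S = \<lparr>pverts = carrier N,
     parcs = {(x, y). x \<in> carrier N \<and> y \<in> carrier N \<and> x \<otimes>\<^bsub>N\<^esub> inv\<^bsub>N\<^esub> y \<in> S}\<rparr>"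

text \<open>A set of permutations of \<open>X\<close>, as a group under composition.\<close>

definition perm_group :: "'v set \<Rightarrow> ('v \<Rightarrow> 'v) set \<Rightarrow> ('v \<Rightarrow> 'v) monoid" where
  "perm_group X G = BijGroup X \<lparr>carrier := G\<rparr>"

definition G_oriented :: "'v pair_pre_digraph \<Rightarrow> ('v \<Rightarrow> 'v) set \<Rightarrow> bool" where
  "G_oriented \<Gamma> G \<longleftrightarrow>
     (\<exists>\<Delta> \<in> orbits (perm_group (pverts \<Gamma>) G) (pverts \<Gamma> \<times> pverts \<Gamma>) (\<lambda>g. map_prod g g).
        \<Delta> \<inter> \<Delta>\<inverse> = {} \<and> parcs \<Gamma> = \<Delta> \<union> \<Delta>\<inverse>)"

definition OG4 :: "('v pair_pre_digraph \<times> ('v \<Rightarrow> 'v) set) set" where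
  "OG4 = {(\<Gamma>, G).
     pair_graph \<Gamma> \<and> connected (with_proj \<Gamma>) \<and>
     (\<forall>x \<in> pverts \<Gamma>. out_degree (with_proj \<Gamma>) x = 4) \<and>
     subgroup G (graph_AutoGroup \<Gamma>) \<and>
     transitive_action (perm_group (pverts \<Gamma>) G) (pverts \<Gamma>) (\<lambda>g. g) \<and>
     transitive_action (perm_group (pverts \<Gamma>) G) (edges \<Gamma>) (\<lambda>g. \<lambda>e \<in> edges \<Gamma>. g ` e) \<and>
     G_oriented \<Gamma> G}"

definition quasiprimitive :: "'v set \<Rightarrow> ('v \<Rightarrow> 'v) set \<Rightarrow> bool" where
  "quasiprimitive X G \<longleftrightarrow>
     (\<forall>M. M \<lhd> perm_group X G \<longrightarrow> M \<noteq> {\<one>\<^bsub>perm_group X G\<^esub>} \<longrightarrow>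
        transitive_action (perm_group X M) X (\<lambda>g. g))"

definition basic_quasiprimitive :: "'v pair_pre_digraph \<Rightarrow> ('v \<Rightarrow> 'v) set \<Rightarrow> bool" where
  "basic_quasiprimitive \<Gamma> G \<longleftrightarrow> (\<Gamma>, G) \<in> OG4 \<and> quasiprimitive (pverts \<Gamma>) G"

text \<open>The semidirect product of \<open>N\<close> by a subgroup \<open>K\<close> of \<open>AutoGroup N\<close>.\<close>

definition semidirect ::
  "('a, 'm) monoid_scheme \<Rightarrow> ('a \<Rightarrow> 'a) set \<Rightarrow> ('a \<times> ('a \<Rightarrow> 'a)) monoid" where
  "semidirect N K = \<lparr>carrier = carrier N \<times> K,
     monoid.mult = (\<lambda>(n, \<sigma>) (m, \<rho>). (n \<otimes>\<^bsub>N\<^esub> \<sigma> m, \<sigma> \<otimes>\<^bsub>AutoGroup N\<^esub> \<rho>)),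
     monoid.one = (\<one>\<^bsub>N\<^esub>, \<one>\<^bsub>AutoGroup N\<^esub>)\<rparr>"

text \<open>
  \<open>semidirect N K\<close> acts on \<open>carrier N\<close>, with \<open>N\<close> acting by right multiplication and \<open>K\<close>
  naturally.  Permutations in \<open>BijGroup\<close> compose from right to left, so \<open>n\<close> has to act as
  \<open>x \<mapsto> x n\<^sup>-\<^sup>1\<close> to give a homomorphism; the permutations obtained from all \<open>n\<close> are the same as
  those given by \<open>x \<mapsto> x n\<close>.
\<close>

definition semidirect_action ::
  "('a, 'm) monoid_scheme \<Rightarrow> 'a \<times> ('a \<Rightarrow> 'a) \<Rightarrow> 'a \<Rightarrow> 'a" where
  "semidirect_action N = (\<lambda>(n, \<sigma>). \<lambda>x \<in> carrier N. \<sigma> x \<otimes>\<^bsub>N\<^esub> inv\<^bsub>N\<^esub> n)"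

end

theory Submission
  imports Defs
begin

text \<open>
  Right translations and the swap \<open>\<tau>\<close> act on the Cayley graph because \<open>\<tau>\<close> preserves \<open>S\<^sub>0\<close>;
  they are transitive on the arcs \<open>(x, sx)\<close> with \<open>s \<in> S\<^sub>0\<close> because \<open>\<tau>\<close> interchanges the
  two elements of \<open>S\<^sub>0\<close>.  The graph is connected by Goursat's lemma: if \<open>(a, b)\<close> and \<open>(b, a)\<close>
  did not generate \<open>T \<times> T\<close>, they would generate the graph of an automorphism of \<open>T\<close>
  interchanging \<open>a\<close> and \<open>b\<close>.  It has valency \<open>4\<close>, and the orientation is proper, because \<open>T\<close> is
  neither cyclic nor dihedral.  Finally, a nontrivial normal subgroup of \<open>N \<rtimes> \<langle>\<tau>\<rangle>\<close> meets \<open>N\<close>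
  nontrivially since \<open>\<tau>\<close> is not inner on \<open>N\<close>, and a nontrivial \<open>\<tau>\<close>-invariant normal subgroup
  of \<open>T \<times> T\<close> contains a commutator in \<open>T \<times> 1\<close>, hence both factors.
\<close>

section \<open>Simple groups and the square of a simple group\<close>

text \<open>The centre is a normal subgroup, so by simplicity it is trivial or everything; the
  second case would make \<open>G\<close> commutative.\<close>

lemma (in simple_group) centre_trivial:
  assumes nc: "\<not> comm_group G" and z: "z \<in> carrier G"
    and comm: "\<And>g. g \<in> carrier G \<Longrightarrow> z \<otimes> g = g \<otimes> z"
  shows "z = \<one>"
proof -
  define Z where "Z = {z \<in> carrier G. \<forall>g \<in> carrier G. z \<otimes> g = g \<otimes> z}"
  have inv_in_Z: "inv x \<in> Z" if "x \<in> Z" for x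
  proof -
    have x: "x \<in> carrier G" "\<And>g. g \<in> carrier G \<Longrightarrow> x \<otimes> g = g \<otimes> x"
      using that by (auto simp: Z_def)
    have "inv x \<otimes> g = g \<otimes> inv x" if g: "g \<in> carrier G" for g
    proof -
      have "inv x \<otimes> g = inv (inv g \<otimes> x)" using x(1) g by (simp add: inv_mult_group)
      also have "\<dots> = inv (x \<otimes> inv g)" using x g by simp
      also have "\<dots> = g \<otimes> inv x" using x(1) g by (simp add: inv_mult_group)
      finally show ?thesis .
    qed
    then show ?thesis using x(1) by (simp add: Z_def)
  qed
  have "subgroup Z G"
  proof (rule subgroupI)
    show "x \<otimes> y \<in> Z" if "x \<in> Z" "y \<in> Z" for x y
    proof -
      have xy: "x \<in> carrier G" "y \<in> carrier G" using that by (auto simp: Z_def)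
      have "x \<otimes> y \<otimes> g = g \<otimes> (x \<otimes> y)" if g: "g \<in> carrier G" for g
      proof -
        have "x \<otimes> y \<otimes> g = x \<otimes> (g \<otimes> y)" using \<open>y \<in> Z\<close> xy g by (simp add: Z_def m_assoc)
        also have "\<dots> = g \<otimes> x \<otimes> y" using \<open>x \<in> Z\<close> xy g by (simp add: Z_def m_assoc[symmetric])
        finally show ?thesis using xy g by (simp add: m_assoc)
      qed
      then show ?thesis using xy by (simp add: Z_def)
    qed
  qed (use inv_in_Z in \<open>auto simp: Z_def intro!: exI[of _ \<one>]\<close>)
  moreover have "x \<otimes> h \<otimes> inv x \<in> Z" if "x \<in> carrier G" "h \<in> Z" for x h
  proof -
    have h: "h \<in> carrier G" "x \<otimes> h = h \<otimes> x" using that by (auto simp: Z_def)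
    then have "x \<otimes> h \<otimes> inv x = h" using that by (simp add: m_assoc)
    then show ?thesis using that by simp
  qed
  ultimately have "Z \<lhd> G" by (simp add: normal_inv_iff)
  then have "Z = carrier G \<or> Z = {\<one>}" by (rule no_real_normal_subgroup)
  moreover have "Z \<noteq> carrier G"
  proof
    assume "Z = carrier G"
    then have "comm_group G"
      by (intro group_comm_groupI) (auto simp: Z_def)
    with nc show False ..
  qed
  ultimately have "Z = {\<one>}" by simp
  moreover have "z \<in> Z" using z comm by (simp add: Z_def)
  ultimately show ?thesis by simp
qed

text \<open>The elements commuting with \<open>z\<close> are closed under products and inverses, so
  commuting with generators already makes \<open>z\<close> central.\<close>

lemma (in simple_group) one_if_commutes_with_generators:
  assumes nc: "\<not> comm_group G" and gen: "generate G H = carrier G" and H: "H \<subseteq> carrier G"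
    and z: "z \<in> carrier G" and comm: "\<And>h. h \<in> H \<Longrightarrow> z \<otimes> h = h \<otimes> z"
  shows "z = \<one>"
proof (rule centre_trivial[OF nc z])
  fix g assume "g \<in> carrier G"
  then have "g \<in> generate G H" by (simp add: gen)
  then show "z \<otimes> g = g \<otimes> z"
  proof (induction rule: generate.induct)
    case (inv h)
    then have h: "h \<in> carrier G" using H by auto
    have "inv h \<otimes> z = inv h \<otimes> (z \<otimes> h) \<otimes> inv h" using h z by (simp add: m_assoc)
    also have "\<dots> = inv h \<otimes> (h \<otimes> z) \<otimes> inv h" using comm[OF inv] by simp
    also have "\<dots> = z \<otimes> inv h" using h z by (simp add: m_assoc[symmetric])
    finally show ?case ..
  next
    case (eng h k)
    then have "h \<in> carrier G" "k \<in> carrier G" by (simp_all add: gen)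
    with z eng.IH show ?case by (metis m_assoc)
  qed (use z comm in auto)
qed

text \<open>If \<open>a\<close> and \<open>b\<close> were involutions, then the dihedral group they generate would have the
  proper normal subgroup \<open>\<langle>ab\<rangle>\<close>.\<close>

lemma (in simple_group) no_two_involution_generators:
  assumes nc: "\<not> comm_group G" and ab: "a \<in> carrier G" "b \<in> carrier G"
    and gen: "generate G {a, b} = carrier G"
    and inv_a: "inv a = a" and inv_b: "inv b = b"
  shows "a = b"
proof -
  have aa: "a \<otimes> a = \<one>" and bb: "b \<otimes> b = \<one>"
    using ab inv_a inv_b by (metis r_inv)+
  have abba: "a \<otimes> b \<otimes> (b \<otimes> a) = \<one>" and baab: "b \<otimes> a \<otimes> (a \<otimes> b) = \<one>"
    using ab aa bb by (metis m_assoc m_closed r_one)+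
  \<comment> \<open>Since \<open>b \<otimes> a\<close> is the inverse of
    \<open>a \<otimes> b\<close>, this set generates the cyclic group of
    \<open>a \<otimes> b\<close>. Conjugation by \<open>a\<close> or by \<open>b\<close>
    interchanges its two elements.\<close>
  let ?H = "{a \<otimes> b, b \<otimes> a}"
  have H: "?H \<subseteq> carrier G" using ab by simp
  have conj_a: "a \<otimes> h \<otimes> a \<in> ?H" if "h \<in> ?H" for h
    using that ab aa by (auto simp: m_assoc) (simp add: m_assoc[symmetric])
  have conj_b: "b \<otimes> h \<otimes> b \<in> ?H" if "h \<in> ?H" for h
    using that ab bb by (auto simp: m_assoc) (simp add: m_assoc[symmetric])
  \<comment> \<open>Normality of a generated subgroup follows from conjugation invariance of its
    generating set, so the induction over words in \<open>a\<close> and \<open>b\<close> concerns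
    \<open>?H\<close> itself.\<close>
  have conj: "\<forall>h \<in> ?H. g \<otimes> h \<otimes> inv g \<in> ?H" if "g \<in> generate G {a, b}" for g
    using that
  proof (induction rule: generate.induct)
    case one
    then show ?case using H by auto
  next
    case (incl h)
    then have "h = a \<or> h = b" by simp
    then show ?case using conj_a conj_b inv_a inv_b by metis
  next
    case (inv h)
    then have "h = a \<or> h = b" by simp
    then show ?case using conj_a conj_b inv_a inv_b by metis
  next
    case (eng g k)
    then have gk: "g \<in> carrier G" "k \<in> carrier G" by (simp_all add: gen)
    show ?case
    proof
      fix h assume h: "h \<in> ?H"
      then have "h \<in> carrier G" using H by blast
      then have "g \<otimes> k \<otimes> h \<otimes> inv (g \<otimes> k) = g \<otimes> (k \<otimes> h \<otimes> inv k) \<otimes> inv g"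
        using gk by (simp add: m_assoc inv_mult_group)
      then show "g \<otimes> k \<otimes> h \<otimes> inv (g \<otimes> k) \<in> ?H" using eng.IH h by metis
    qed
  qed
  have "generate G ?H \<lhd> G"
    using H conj by (intro normal_generateI) (auto simp: gen)
  then consider "generate G ?H = carrier G" | "generate G ?H = {\<one>}"
    using no_real_normal_subgroup by blast
  then have "a \<otimes> b = \<one>"
  proof cases
    case 1
    \<comment> \<open>Here \<open>G\<close> would be cyclic: \<open>a \<otimes> b\<close> commutes
      with itself and with its inverse, which generate \<open>G\<close>.\<close>
    show ?thesis
      by (rule one_if_commutes_with_generators[OF nc 1 H]) (use ab abba baab in auto)
  next
    case 2
    then show ?thesis using generate.incl[of "a \<otimes> b" ?H G] by auto
  qed
  then show ?thesis using ab inv_a by (metis inv_equality inv_inv)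
qed

text \<open>Goursat's argument: a proper subgroup of \<open>T \<times> T\<close> that projects onto both factors meets
  \<open>T \<times> 1\<close> trivially, hence it is the graph of an automorphism.\<close>

lemma (in simple_group) generate_swapped_pair:
  assumes fin: "finite (carrier G)"
    and ab: "a \<in> carrier G" "b \<in> carrier G" and gen: "generate G {a, b} = carrier G"
    and no_swap: "\<not> (\<exists>\<phi> \<in> auto G. \<phi> a = b \<and> \<phi> b = a)"
  shows "generate (G \<times>\<times> G) {(a, b), (b, a)} = carrier (G \<times>\<times> G)"
proof -
  interpret GG: group "G \<times>\<times> G" by (intro DirProd_group) (rule group_axioms)+
  define H where "H = generate (G \<times>\<times> G) {(a, b), (b, a)}"
  have H: "subgroup H (G \<times>\<times> G)"
    unfolding H_def using ab by (intro GG.generate_is_subgroup) auto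
  have mult: "(x \<otimes> x', y \<otimes> y') \<in> H" if "(x, y) \<in> H" "(x', y') \<in> H" for x x' y y'
    using subgroup.m_closed[OF H that] by simp
  have sub: "x \<in> carrier G \<and> y \<in> carrier G" if "(x, y) \<in> H" for x y
    using subgroup.subset[OF H] that by auto
  have inv: "(inv x, inv y) \<in> H" if "(x, y) \<in> H" for x y
    using subgroup.m_inv_closed[OF H that] sub[OF that] by (simp add: group_axioms)
  have one: "(\<one>, \<one>) \<in> H" using subgroup.one_closed[OF H] by simp
  have gens: "(a, b) \<in> H" "(b, a) \<in> H" unfolding H_def by (auto intro: generate.incl)
  \<comment> \<open>Both projections of \<open>H\<close> contain \<open>a\<close> and
    \<open>b\<close>, hence all of \<open>G\<close>.\<close>
  have proj1: "\<exists>y. (x, y) \<in> H" and proj2: "\<exists>y. (y, x) \<in> H" if "x \<in> carrier G" for x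
  proof -
    have "x \<in> generate G {a, b}" using that gen by simp
    then have "(\<exists>y. (x, y) \<in> H) \<and> (\<exists>y. (y, x) \<in> H)"
      by (induction rule: generate.induct) (use one gens inv mult in blast)+
    then show "\<exists>y. (x, y) \<in> H" "\<exists>y. (y, x) \<in> H" by auto
  qed
  \<comment> \<open>This is the intersection of \<open>H\<close> with the first factor. It is normal
    in \<open>G\<close> because each \<open>x\<close> lifts to some \<open>(x, y) \<in> H\<close>,
    and conjugation by that element keeps the second coordinate trivial.\<close>
  define L where "L = {x. (x, \<one>) \<in> H}"
  have "subgroup L G"
    by (rule subgroupI) (use one mult inv sub in \<open>fastforce simp: L_def\<close>)+
  moreover have "x \<otimes> h \<otimes> inv x \<in> L" if x: "x \<in> carrier G" and h: "h \<in> L" for x h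
  proof -
    obtain y where y: "(x, y) \<in> H" using proj1[OF x] by auto
    then have "(x \<otimes> h \<otimes> inv x, y \<otimes> \<one> \<otimes> inv y) \<in> H"
      using h by (intro mult inv) (auto simp: L_def)
    then show ?thesis using sub[OF y] by (simp add: L_def)
  qed
  ultimately have "L \<lhd> G" by (simp add: normal_inv_iff)
  then consider "L = carrier G" | "L = {\<one>}" using no_real_normal_subgroup by blast
  then have "carrier (G \<times>\<times> G) \<subseteq> H"
  proof cases
    case 1
    have "(x, y) \<in> H" if "x \<in> carrier G" "y \<in> carrier G" for x y
    proof -
      \<comment> \<open>With the first factor inside \<open>H\<close>, any \<open>(x, y)\<close>
        factors as \<open>(x \<otimes> inv u, \<one>)\<close> times \<open>(u, y)\<close>.\<close>
      obtain u where u: "(u, y) \<in> H" using proj2[OF \<open>y \<in> carrier G\<close>] by auto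
      then have "x \<otimes> inv u \<in> L" using 1 that sub by auto
      then have "(x \<otimes> inv u \<otimes> u, \<one> \<otimes> y) \<in> H" using u by (intro mult) (auto simp: L_def)
      then show ?thesis using that sub[OF u] by (simp add: m_assoc)
    qed
    then show ?thesis by auto
  next
    case 2
    \<comment> \<open>The quotient of two elements with equal second coordinate lies in the first
      factor, where \<open>H\<close> is trivial.\<close>
    have unique: "x = x'" if "(x, y) \<in> H" "(x', y) \<in> H" for x x' y
    proof -
      have "(x \<otimes> inv x', y \<otimes> inv y) \<in> H" using that by (intro mult inv)
      then have "x \<otimes> inv x' \<in> L" using sub[OF that(1)] by (simp add: L_def)
      then show ?thesis using 2 sub that by (metis inv_equality inv_inv inv_closed singletonD)
    qed
    \<comment> \<open>The map goes from second to first coordinates. The restriction to the carrier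
      makes it extensional, as membership in \<open>auto G\<close> requires.\<close>
    define \<phi> where "\<phi> = (\<lambda>y \<in> carrier G. THE x. (x, y) \<in> H)"
    have \<phi>_eq: "\<phi> y = x" if "(x, y) \<in> H" for x y
      using that sub[OF that] unique unfolding \<phi>_def by (auto intro: the_equality)
    have \<phi>_in: "(\<phi> y, y) \<in> H" if "y \<in> carrier G" for y
      using proj2[OF that] \<phi>_eq by auto
    have "\<phi> \<in> hom G G"
    proof (rule homI)
      fix x y assume xy: "x \<in> carrier G" "y \<in> carrier G"
      show "\<phi> x \<in> carrier G" using sub[OF \<phi>_in[OF xy(1)]] by simp
      show "\<phi> (x \<otimes> y) = \<phi> x \<otimes> \<phi> y" by (intro \<phi>_eq mult \<phi>_in xy)
    qed
    moreover have "bij_betw \<phi> (carrier G) (carrier G)"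
    proof -
      have "\<phi> ` carrier G = carrier G"
      proof
        show "\<phi> ` carrier G \<subseteq> carrier G" using \<phi>_in sub by blast
        show "carrier G \<subseteq> \<phi> ` carrier G"
        proof
          fix x assume "x \<in> carrier G"
          then obtain y where "(x, y) \<in> H" using proj1 by blast
          then show "x \<in> \<phi> ` carrier G" using \<phi>_eq sub by (metis imageI)
        qed
      qed
      \<comment> \<open>Finiteness turns surjectivity into injectivity, so the second factor needs
        no separate argument.\<close>
      then show ?thesis using fin by (simp add: bij_betw_def eq_card_imp_inj_on)
    qed
    ultimately have "\<phi> \<in> auto G"
      by (simp add: auto_def Bij_def \<phi>_def)
    moreover have "\<phi> a = b" "\<phi> b = a" using gens \<phi>_eq by auto
    ultimately show ?thesis using no_swap by blast
  qed
  then show ?thesis using subgroup.subset[OF H] unfolding H_def by blast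
qed

text \<open>For \<open>(s, t) \<in> M\<close> and \<open>u\<close> not commuting with
  \<open>s\<close>, the commutator of \<open>(u, \<one>)\<close> and \<open>(s, t)\<close> is a
  nontrivial element of \<open>M\<close> in the first factor. By simplicity \<open>M\<close>
  contains that factor, and by the swap also the other one.\<close>

lemma (in simple_group) swap_invariant_normal_subgroup_square:
  assumes nc: "\<not> comm_group G" and M: "M \<lhd> G \<times>\<times> G" and nontriv: "M \<noteq> {\<one>\<^bsub>G \<times>\<times> G\<^esub>}"
    and swap: "\<And>x y. (x, y) \<in> M \<Longrightarrow> (y, x) \<in> M"
  shows "M = carrier (G \<times>\<times> G)"
proof -
  interpret GG: group "G \<times>\<times> G" by (intro DirProd_group) (rule group_axioms)+
  note M_sub = normal_imp_subgroup[OF M]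
  have mult: "(x \<otimes> x', y \<otimes> y') \<in> M" if "(x, y) \<in> M" "(x', y') \<in> M" for x x' y y'
    using subgroup.m_closed[OF M_sub that] by simp
  have sub: "x \<in> carrier G \<and> y \<in> carrier G" if "(x, y) \<in> M" for x y
    using subgroup.subset[OF M_sub] that by auto
  have inv: "(inv x, inv y) \<in> M" if "(x, y) \<in> M" for x y
    using subgroup.m_inv_closed[OF M_sub that] sub[OF that] by (simp add: group_axioms)
  have one: "(\<one>, \<one>) \<in> M" using subgroup.one_closed[OF M_sub] by simp
  have conj: "(u \<otimes> x \<otimes> inv u, y) \<in> M" if "(x, y) \<in> M" "u \<in> carrier G" for x y u
    using normal.inv_op_closed2[OF M, of "(u, \<one>)" "(x, y)"] that sub[OF that(1)]
    by (simp add: group_axioms)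
  \<comment> \<open>A nontrivial element of \<open>M\<close> has a nontrivial coordinate; the swap
    moves it to the first place if necessary.\<close>
  obtain s t where st: "(s, t) \<in> M" "s \<noteq> \<one>"
    using nontriv one swap by auto
  then have s: "s \<in> carrier G" using sub by simp
  obtain u where u: "u \<in> carrier G" "s \<otimes> u \<noteq> u \<otimes> s"
    using centre_trivial[OF nc s] st(2) by blast
  define L where "L = {x. (x, \<one>) \<in> M}"
  have "subgroup L G"
    by (rule subgroupI) (use one mult inv sub in \<open>fastforce simp: L_def\<close>)+
  moreover have "x \<otimes> h \<otimes> inv x \<in> L" if "x \<in> carrier G" "h \<in> L" for x h
    using that conj by (simp add: L_def)
  ultimately have "L \<lhd> G" by (simp add: normal_inv_iff)
  moreover have "u \<otimes> s \<otimes> inv u \<otimes> inv s \<in> L"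
    using mult[OF conj[OF st(1) u(1)] inv[OF st(1)]] sub[OF st(1)] by (simp add: L_def)
  moreover have "u \<otimes> s \<otimes> inv u \<otimes> inv s \<noteq> \<one>"
  proof
    assume "u \<otimes> s \<otimes> inv u \<otimes> inv s = \<one>"
    then have "u \<otimes> s \<otimes> inv u = s" using u s by (metis inv_closed inv_equality inv_inv m_closed)
    then show False using u s by (metis inv_solve_right m_closed)
  qed
  ultimately have "L = carrier G" using no_real_normal_subgroup by blast
  then have "(x \<otimes> \<one>, \<one> \<otimes> y) \<in> M" if "x \<in> carrier G" "y \<in> carrier G" for x y
    using that by (intro mult swap[of y \<one>]) (auto simp: L_def)
  then show ?thesis using sub by auto
qed

section \<open>Permutation groups and Cayley graphs\<close>

lemma compose_in_BijGroup:
  "f \<in> Bij X \<Longrightarrow> g \<in> Bij X \<Longrightarrow> f \<otimes>\<^bsub>BijGroup X\<^esub> g = compose X f g"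
  by (simp add: BijGroup_def)

lemma subgroup_BijGroup_imp_Bij: "subgroup H (BijGroup X) \<Longrightarrow> h \<in> H \<Longrightarrow> h \<in> Bij X"
  using subgroup.subset by (fastforce simp: BijGroup_def)

lemma perm_group_action:
  assumes H: "subgroup H (BijGroup X)"
  shows "group_action (perm_group X H) X (\<lambda>g. g)"
proof -
  have "(\<lambda>g. g) \<in> hom (perm_group X H) (BijGroup X)"
    using subgroup.subset[OF H] by (intro homI) (auto simp: perm_group_def)
  moreover have "group (perm_group X H)"
    unfolding perm_group_def by (rule group.subgroup_imp_group[OF group_BijGroup H])
  ultimately show ?thesis
    by (simp add: group_action_def group_hom_def group_hom_axioms_def group_BijGroup)
qed

text \<open>This lets a permutation group that consists of graph automorphisms be regarded as a
  subgroup of \<open>graph_AutoGroup \<Gamma>\<close>.\<close>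

lemma subgroup_graph_auto: "subgroup (graph_auto \<Gamma>) (BijGroup (pverts \<Gamma>))"
proof (rule group.subgroupI[OF group_BijGroup])
  show "graph_auto \<Gamma> \<subseteq> carrier (BijGroup (pverts \<Gamma>))"
    by (auto simp: graph_auto_def BijGroup_def)
  have "(\<lambda>x \<in> pverts \<Gamma>. x) \<in> graph_auto \<Gamma>" by (simp add: graph_auto_def id_Bij)
  then show "graph_auto \<Gamma> \<noteq> {}" by blast
next
  fix f assume f: "f \<in> graph_auto \<Gamma>"
  then have bij: "f \<in> Bij (pverts \<Gamma>)" by (simp add: graph_auto_def)
  let ?g = "\<lambda>x \<in> pverts \<Gamma>. inv_into (pverts \<Gamma>) f x"
  have "f ` pverts \<Gamma> = pverts \<Gamma>" using bij by (simp add: Bij_def bij_betw_def)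
  then have fg: "f (inv_into (pverts \<Gamma>) f x) = x" if "x \<in> pverts \<Gamma>" for x
    using that by (simp add: f_inv_into_f)
  have "(?g x, ?g y) \<in> parcs \<Gamma> \<longleftrightarrow> (x, y) \<in> parcs \<Gamma>" if "x \<in> pverts \<Gamma>" "y \<in> pverts \<Gamma>" for x y
  proof -
    have "inv_into (pverts \<Gamma>) f x \<in> pverts \<Gamma>" "inv_into (pverts \<Gamma>) f y \<in> pverts \<Gamma>"
      using Bij_inv_into_mem[OF bij] that by auto
    then have "(?g x, ?g y) \<in> parcs \<Gamma> \<longleftrightarrow> (f (?g x), f (?g y)) \<in> parcs \<Gamma>"
      using f that by (simp add: graph_auto_def)
    then show ?thesis using fg that by simp
  qed
  then show "inv\<^bsub>BijGroup (pverts \<Gamma>)\<^esub> f \<in> graph_auto \<Gamma>"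
    using bij by (simp add: inv_BijGroup graph_auto_def restrict_inv_into_Bij del: restrict_apply)
next
  fix f g assume fg: "f \<in> graph_auto \<Gamma>" "g \<in> graph_auto \<Gamma>"
  then have bij: "f \<in> Bij (pverts \<Gamma>)" "g \<in> Bij (pverts \<Gamma>)" by (auto simp: graph_auto_def)
  then have "g x \<in> pverts \<Gamma>" if "x \<in> pverts \<Gamma>" for x
    using that Bij_imp_funcset by blast
  then show "f \<otimes>\<^bsub>BijGroup (pverts \<Gamma>)\<^esub> g \<in> graph_auto \<Gamma>"
    using fg bij by (simp add: compose_in_BijGroup graph_auto_def compose_Bij compose_eq)
qed

lemma graph_auto_image_edge:
  assumes arcs: "parcs \<Gamma> \<subseteq> pverts \<Gamma> \<times> pverts \<Gamma>" and f: "f \<in> graph_auto \<Gamma>" and e: "e \<in> edges \<Gamma>"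
  shows "f ` e \<in> edges \<Gamma>"
proof -
  obtain x y where xy: "e = {x, y}" "(x, y) \<in> parcs \<Gamma>" using e by (auto simp: edges_def)
  then have "(f x, f y) \<in> parcs \<Gamma>" using arcs f by (auto simp: graph_auto_def)
  then show ?thesis using xy by (auto simp: edges_def)
qed

text \<open>Transitivity on edges in \<open>OG4\<close> presupposes a homomorphism into
  \<open>BijGroup (edges \<Gamma>)\<close>. The map induced on edges is bijective because the
  inverse permutation lies in \<open>H\<close> and induces the inverse map.\<close>

lemma edge_action:
  assumes arcs: "parcs \<Gamma> \<subseteq> pverts \<Gamma> \<times> pverts \<Gamma>"
    and H: "subgroup H (BijGroup (pverts \<Gamma>))" and auts: "H \<subseteq> graph_auto \<Gamma>"
  shows "group_action (perm_group (pverts \<Gamma>) H) (edges \<Gamma>) (\<lambda>g. \<lambda>e \<in> edges \<Gamma>. g ` e)"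
proof -
  interpret B: group "BijGroup (pverts \<Gamma>)" by (rule group_BijGroup)
  have bij: "g \<in> Bij (pverts \<Gamma>)" if "g \<in> H" for g
    using subgroup_BijGroup_imp_Bij[OF H that] .
  have sub: "e \<subseteq> pverts \<Gamma>" if "e \<in> edges \<Gamma>" for e
    using that arcs by (auto simp: edges_def)
  have comp: "(f \<otimes>\<^bsub>BijGroup (pverts \<Gamma>)\<^esub> g) ` e = f ` g ` e"
    if "f \<in> H" "g \<in> H" "e \<in> edges \<Gamma>" for f g e
    using sub[OF that(3)] bij that by (auto simp: compose_in_BijGroup compose_eq image_iff subset_eq)
  have one: "\<one>\<^bsub>BijGroup (pverts \<Gamma>)\<^esub> ` e = e" if "e \<in> edges \<Gamma>" for e
    using sub[OF that] by (auto simp: BijGroup_def)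
  have Bij_edges: "(\<lambda>e \<in> edges \<Gamma>. g ` e) \<in> Bij (edges \<Gamma>)" if g: "g \<in> H" for g
  proof -
    let ?h = "inv\<^bsub>BijGroup (pverts \<Gamma>)\<^esub> g"
    have h: "?h \<in> H" using subgroup.m_inv_closed[OF H g] .
    have g': "g \<in> carrier (BijGroup (pverts \<Gamma>))" using subgroup.subset[OF H] g by blast
    have "bij_betw (\<lambda>e. g ` e) (edges \<Gamma>) (edges \<Gamma>)"
    proof (rule bij_betw_byWitness[where f' = "\<lambda>e. ?h ` e"])
      show "\<forall>e \<in> edges \<Gamma>. ?h ` g ` e = e"
        using comp[OF h g] one g' by simp
      show "\<forall>e \<in> edges \<Gamma>. g ` ?h ` e = e"
        using comp[OF g h] one g' by simp
    qed (use graph_auto_image_edge[OF arcs] auts g h in blast)+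
    then show ?thesis by (simp add: Bij_def cong: bij_betw_cong)
  qed
  have "(\<lambda>g. \<lambda>e \<in> edges \<Gamma>. g ` e) \<in> hom (perm_group (pverts \<Gamma>) H) (BijGroup (edges \<Gamma>))"
  proof (rule homI)
    fix f g assume "f \<in> carrier (perm_group (pverts \<Gamma>) H)" "g \<in> carrier (perm_group (pverts \<Gamma>) H)"
    then have fg: "f \<in> H" "g \<in> H" by (auto simp: perm_group_def)
    have "(\<lambda>e \<in> edges \<Gamma>. (f \<otimes>\<^bsub>BijGroup (pverts \<Gamma>)\<^esub> g) ` e)
        = compose (edges \<Gamma>) (\<lambda>e \<in> edges \<Gamma>. f ` e) (\<lambda>e \<in> edges \<Gamma>. g ` e)"
    proof
      fix e
      show "(\<lambda>e \<in> edges \<Gamma>. (f \<otimes>\<^bsub>BijGroup (pverts \<Gamma>)\<^esub> g) ` e) e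
        = compose (edges \<Gamma>) (\<lambda>e \<in> edges \<Gamma>. f ` e) (\<lambda>e \<in> edges \<Gamma>. g ` e) e"
        using comp[OF fg] graph_auto_image_edge[OF arcs, of g e] auts fg
        by (cases "e \<in> edges \<Gamma>") (auto simp: compose_def)
    qed
    then show "(\<lambda>e \<in> edges \<Gamma>. (f \<otimes>\<^bsub>perm_group (pverts \<Gamma>) H\<^esub> g) ` e)
        = (\<lambda>e \<in> edges \<Gamma>. f ` e) \<otimes>\<^bsub>BijGroup (edges \<Gamma>)\<^esub> (\<lambda>e \<in> edges \<Gamma>. g ` e)"
      using Bij_edges fg by (simp add: perm_group_def compose_in_BijGroup)
  qed (use Bij_edges in \<open>auto simp: perm_group_def BijGroup_def\<close>)
  moreover have "group (perm_group (pverts \<Gamma>) H)"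
    unfolding perm_group_def by (rule B.subgroup_imp_group[OF H])
  ultimately show ?thesis
    by (simp add: group_action_def group_hom_def group_hom_axioms_def group_BijGroup)
qed

section \<open>Cayley graphs: symmetry, connectedness and valency\<close>

lemma (in group) cayley_graph_symmetric:
  assumes "(\<lambda>s. inv s) ` S \<subseteq> S" and "(x, y) \<in> parcs (cayley_graph G S)"
  shows "(y, x) \<in> parcs (cayley_graph G S)"
proof -
  have xy: "x \<in> carrier G" "y \<in> carrier G" "x \<otimes> inv y \<in> S"
    using assms(2) by (auto simp: cayley_graph_def)
  then have "inv (x \<otimes> inv y) \<in> S" using assms(1) by blast
  then show ?thesis using xy by (simp add: cayley_graph_def inv_mult_group)
qed

lemma (in group) pair_graph_cayley_graph:
  assumes fin: "finite (carrier G)" and inv: "(\<lambda>s. inv s) ` S \<subseteq> S" and one: "\<one> \<notin> S"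
  shows "pair_graph (cayley_graph G S)"
proof
  show "finite (pverts (cayley_graph G S))" using fin by (simp add: cayley_graph_def)
  show "finite (parcs (cayley_graph G S))"
    by (rule finite_subset[of _ "carrier G \<times> carrier G"]) (use fin in \<open>auto simp: cayley_graph_def\<close>)
  show "symmetric (with_proj (cayley_graph G S))"
    using cayley_graph_symmetric[OF inv] by (auto simp: symmetric_def sym_def)
  show "fst e \<noteq> snd e" if "e \<in> parcs (cayley_graph G S)" for e
    using that one by (auto simp: cayley_graph_def)
qed (auto simp: cayley_graph_def)

text \<open>Left multiplication by a generator moves along an arc, so a word for \<open>g\<close>
  gives a walk from \<open>x\<close> to \<open>g \<otimes> x\<close>. The choice
  \<open>g = y \<otimes> inv x\<close> reaches any \<open>y\<close>.\<close>

lemma (in group) connected_cayley_graph: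
  assumes fin: "finite (carrier G)" and S: "S \<subseteq> carrier G"
    and inv: "(\<lambda>s. inv s) ` S \<subseteq> S" and one: "\<one> \<notin> S"
    and gen: "generate G S = carrier G"
  shows "connected (with_proj (cayley_graph G S))"
proof -
  let ?\<Gamma> = "with_proj (cayley_graph G S)"
  interpret pair_graph "cayley_graph G S" by (rule pair_graph_cayley_graph[OF fin inv one])
  have step: "x \<rightarrow>\<^sup>*\<^bsub>?\<Gamma>\<^esub> (s \<otimes> x)" if s: "s \<in> S" and x: "x \<in> carrier G" for s x
  proof -
    have "s \<in> carrier G" using s S by blast
    moreover have "inv s \<in> S" using s inv by blast
    ultimately have "(x, s \<otimes> x) \<in> parcs (cayley_graph G S)"
      using x by (simp add: cayley_graph_def inv_mult_group m_assoc[symmetric])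
    then show ?thesis by (intro reachable_adjI) simp
  qed
  have reach: "x \<rightarrow>\<^sup>*\<^bsub>?\<Gamma>\<^esub> (g \<otimes> x)" if "g \<in> generate G S" "x \<in> carrier G" for g x
    using that
  proof (induction arbitrary: x rule: generate.induct)
    case one
    then have "x \<in> pverts (cayley_graph G S)" by (simp add: cayley_graph_def)
    then show ?case using one by simp
  next
    case (incl s)
    then show ?case by (rule step)
  next
    case (inv s)
    then show ?case using assms(3) by (intro step) auto
  next
    case (eng g h)
    then have gh: "g \<in> carrier G" "h \<in> carrier G" by (simp_all add: gen)
    have "x \<rightarrow>\<^sup>*\<^bsub>?\<Gamma>\<^esub> (h \<otimes> x)" by (rule eng.IH(2)[OF eng.prems])
    also have "(h \<otimes> x) \<rightarrow>\<^sup>*\<^bsub>?\<Gamma>\<^esub> (g \<otimes> (h \<otimes> x))" using eng.IH(1) gh eng.prems by simp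
    finally show ?case using gh eng.prems by (simp add: m_assoc)
  qed
  have "x \<rightarrow>\<^sup>*\<^bsub>?\<Gamma>\<^esub> y" if "x \<in> carrier G" "y \<in> carrier G" for x y
    using reach[of "y \<otimes> inv x" x] that by (simp add: gen m_assoc)
  then have "strongly_connected ?\<Gamma>"
    by (intro strongly_connectedI) (auto simp: cayley_graph_def)
  \<comment> \<open>\<open>connected\<close> refers to the symmetric closure, which adds no arcs
    here.\<close>
  moreover have "mk_symmetric ?\<Gamma> = cayley_graph G S"
    using cayley_graph_symmetric[OF inv] unfolding mk_symmetric_def
    by (auto intro!: pair_pre_digraph.equality)
  ultimately show ?thesis unfolding connected_def by simp
qed

text \<open>The neighbours of \<open>x\<close> are the elements \<open>inv s \<otimes> x\<close>,
  and \<open>s\<close> is recovered from the arc \<open>(x, y)\<close> as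
  \<open>x \<otimes> inv y\<close>.\<close>

lemma (in group) out_degree_cayley_graph:
  assumes S: "S \<subseteq> carrier G" and x: "x \<in> carrier G"
  shows "out_degree (with_proj (cayley_graph G S)) x = card S"
proof -
  have "bij_betw (\<lambda>s. (x, inv s \<otimes> x)) S (out_arcs (with_proj (cayley_graph G S)) x)"
  proof (rule bij_betw_byWitness[where f' = "\<lambda>(x, y). x \<otimes> inv y"])
    show "\<forall>s \<in> S. (\<lambda>(x, y). x \<otimes> inv y) (x, inv s \<otimes> x) = s"
      using S x by (auto simp: inv_mult_group m_assoc[symmetric] subset_eq)
    show "\<forall>e \<in> out_arcs (with_proj (cayley_graph G S)) x.
        (x, inv (case e of (x, y) \<Rightarrow> x \<otimes> inv y) \<otimes> x) = e"
      using x by (auto simp: out_arcs_def cayley_graph_def inv_mult_group m_assoc)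
    show "(\<lambda>s. (x, inv s \<otimes> x)) ` S \<subseteq> out_arcs (with_proj (cayley_graph G S)) x"
      using S x by (auto simp: out_arcs_def cayley_graph_def inv_mult_group m_assoc[symmetric] subset_eq)
    show "(\<lambda>(x, y). x \<otimes> inv y) ` out_arcs (with_proj (cayley_graph G S)) x \<subseteq> S"
      by (auto simp: out_arcs_def cayley_graph_def)
  qed
  then show ?thesis unfolding out_degree_def using bij_betw_same_card by metis
qed

section \<open>The action of a semidirect product on its normal factor\<close>

text \<open>The semidirect product is treated for an arbitrary group \<open>K\<close> of
  automorphisms; the swap enters only when the locale is interpreted. The permutation group induced
  on the carrier of \<open>N\<close> is called \<open>perms\<close>.\<close>

locale automorphism_subgroup = group N for N (structure) +
  fixes K
  assumes K: "subgroup K (AutoGroup N)"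
begin

abbreviation "idN \<equiv> \<one>\<^bsub>AutoGroup N\<^esub>"
abbreviation "act \<equiv> semidirect_action N"
abbreviation "perms \<equiv> act ` carrier (semidirect N K)"

lemma K_auto: "\<sigma> \<in> K \<Longrightarrow> \<sigma> \<in> auto N"
  using subgroup.subset[OF K] by (auto simp: AutoGroup_def)

lemma K_hom: "\<sigma> \<in> K \<Longrightarrow> \<sigma> \<in> hom N N"
  and K_Bij: "\<sigma> \<in> K \<Longrightarrow> \<sigma> \<in> Bij (carrier N)"
  using K_auto by (auto simp: auto_def)

lemma K_group_hom: "\<sigma> \<in> K \<Longrightarrow> group_hom N N \<sigma>"
  using K_hom by (simp add: group_hom_def group_hom_axioms_def group_axioms)

lemma K_closed [simp]: "\<sigma> \<in> K \<Longrightarrow> x \<in> carrier N \<Longrightarrow> \<sigma> x \<in> carrier N"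
  using K_hom by (auto simp: hom_def)

lemma K_apply_mult [simp]:
  "\<sigma> \<in> K \<Longrightarrow> x \<in> carrier N \<Longrightarrow> y \<in> carrier N \<Longrightarrow> \<sigma> (x \<otimes> y) = \<sigma> x \<otimes> \<sigma> y"
  using K_hom by (auto simp: hom_def)

lemma K_apply_one [simp]: "\<sigma> \<in> K \<Longrightarrow> \<sigma> \<one> = \<one>"
  using group_hom.hom_one[OF K_group_hom] .

lemma K_apply_inv [simp]: "\<sigma> \<in> K \<Longrightarrow> x \<in> carrier N \<Longrightarrow> \<sigma> (inv x) = inv (\<sigma> x)"
  using group_hom.hom_inv[OF K_group_hom] .

lemma K_inj: "\<sigma> \<in> K \<Longrightarrow> x \<in> carrier N \<Longrightarrow> y \<in> carrier N \<Longrightarrow> \<sigma> x = \<sigma> y \<longleftrightarrow> x = y"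
  using K_Bij by (auto simp: Bij_def bij_betw_def inj_on_def)

lemma idN_eq: "idN = (\<lambda>x \<in> carrier N. x)"
  by (simp add: AutoGroup_def BijGroup_def)

lemma idN_apply [simp]: "x \<in> carrier N \<Longrightarrow> idN x = x"
  by (simp add: idN_eq)

lemma idN_in_K [simp]: "idN \<in> K"
  by (rule subgroup.one_closed[OF K])

lemma K_mult_closed [simp]: "\<sigma> \<in> K \<Longrightarrow> \<rho> \<in> K \<Longrightarrow> \<sigma> \<otimes>\<^bsub>AutoGroup N\<^esub> \<rho> \<in> K"
  by (rule subgroup.m_closed[OF K])

lemma K_mult_apply [simp]:
  "\<sigma> \<in> K \<Longrightarrow> \<rho> \<in> K \<Longrightarrow> x \<in> carrier N \<Longrightarrow> (\<sigma> \<otimes>\<^bsub>AutoGroup N\<^esub> \<rho>) x = \<sigma> (\<rho> x)"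
  using K_Bij by (simp add: AutoGroup_def compose_in_BijGroup compose_eq)

lemma K_l_one [simp]: "\<sigma> \<in> K \<Longrightarrow> idN \<otimes>\<^bsub>AutoGroup N\<^esub> \<sigma> = \<sigma>"
  and K_r_one [simp]: "\<sigma> \<in> K \<Longrightarrow> \<sigma> \<otimes>\<^bsub>AutoGroup N\<^esub> idN = \<sigma>"
  using subgroup.mem_carrier[OF K] group.is_monoid[OF AutoGroup]
  by (auto simp: monoid.l_one monoid.r_one)

lemma carrier_semidirect [simp]: "carrier (semidirect N K) = carrier N \<times> K"
  by (simp add: semidirect_def)

lemma mult_semidirect [simp]:
  "(n, \<sigma>) \<otimes>\<^bsub>semidirect N K\<^esub> (m, \<rho>) = (n \<otimes> \<sigma> m, \<sigma> \<otimes>\<^bsub>AutoGroup N\<^esub> \<rho>)"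
  by (simp add: semidirect_def)

lemma one_semidirect [simp]: "\<one>\<^bsub>semidirect N K\<^esub> = (\<one>, idN)"
  by (simp add: semidirect_def)

lemma group_semidirect: "group (semidirect N K)"
proof (rule groupI)
  fix p q r
  assume "p \<in> carrier (semidirect N K)" "q \<in> carrier (semidirect N K)" "r \<in> carrier (semidirect N K)"
  then show "p \<otimes>\<^bsub>semidirect N K\<^esub> q \<otimes>\<^bsub>semidirect N K\<^esub> r
      = p \<otimes>\<^bsub>semidirect N K\<^esub> (q \<otimes>\<^bsub>semidirect N K\<^esub> r)"
    using subgroup.mem_carrier[OF K] group.is_monoid[OF AutoGroup]
    by (auto simp: m_assoc monoid.m_assoc)
next
  fix p assume "p \<in> carrier (semidirect N K)"
  then obtain n \<sigma> where p: "p = (n, \<sigma>)" "n \<in> carrier N" "\<sigma> \<in> K" by auto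
  define \<rho> where "\<rho> = inv\<^bsub>AutoGroup N\<^esub> \<sigma>"
  have \<rho>: "\<rho> \<in> K" unfolding \<rho>_def by (rule subgroup.m_inv_closed[OF K p(3)])
  have "\<rho> \<otimes>\<^bsub>AutoGroup N\<^esub> \<sigma> = idN"
    unfolding \<rho>_def using subgroup.mem_carrier[OF K p(3)] by (rule group.l_inv[OF AutoGroup])
  \<comment> \<open>The first coordinate of the product is
    \<open>inv (\<rho> n) \<otimes> \<rho> n\<close>, which dictates this left inverse.\<close>
  then have "(inv (\<rho> n), \<rho>) \<otimes>\<^bsub>semidirect N K\<^esub> p = \<one>\<^bsub>semidirect N K\<^esub>"
    using p \<rho> by simp
  then show "\<exists>q \<in> carrier (semidirect N K). q \<otimes>\<^bsub>semidirect N K\<^esub> p = \<one>\<^bsub>semidirect N K\<^esub>"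
    using p \<rho> by (intro bexI[of _ "(inv (\<rho> n), \<rho>)"]) auto
qed auto

lemma act_apply [simp]: "x \<in> carrier N \<Longrightarrow> act (n, \<sigma>) x = \<sigma> x \<otimes> inv n"
  by (simp add: semidirect_action_def)

lemma act_Bij: "n \<in> carrier N \<Longrightarrow> \<sigma> \<in> K \<Longrightarrow> act (n, \<sigma>) \<in> Bij (carrier N)"
proof -
  assume n: "n \<in> carrier N" and \<sigma>: "\<sigma> \<in> K"
  have "bij_betw (\<lambda>x. x \<otimes> inv n) (carrier N) (carrier N)"
    by (rule bij_betw_byWitness[where f' = "\<lambda>x. x \<otimes> n"]) (use n in \<open>auto simp: m_assoc\<close>)
  moreover have "bij_betw \<sigma> (carrier N) (carrier N)" using K_Bij[OF \<sigma>] by (simp add: Bij_def)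
  ultimately have "bij_betw (\<lambda>x. \<sigma> x \<otimes> inv n) (carrier N) (carrier N)"
    using bij_betw_trans by (fastforce simp: comp_def)
  then show ?thesis
    by (simp add: Bij_def semidirect_action_def cong: bij_betw_cong)
qed

text \<open>The computation is \<open>\<sigma> (\<rho> x \<otimes> inv m) \<otimes> inv n = \<sigma>
  (\<rho> x) \<otimes> inv (n \<otimes> \<sigma> m)\<close>. Off the carrier both sides are
  \<open>undefined\<close>.\<close>

lemma act_hom: "group_hom (semidirect N K) (BijGroup (carrier N)) act"
proof -
  have "act \<in> hom (semidirect N K) (BijGroup (carrier N))"
  proof (rule homI)
    fix p assume "p \<in> carrier (semidirect N K)"
    then show "act p \<in> carrier (BijGroup (carrier N))" using act_Bij by (auto simp: BijGroup_def)
  next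
    fix p q assume "p \<in> carrier (semidirect N K)" "q \<in> carrier (semidirect N K)"
    then obtain n \<sigma> m \<rho> where pq: "p = (n, \<sigma>)" "q = (m, \<rho>)"
      and in_carrier: "n \<in> carrier N" "\<sigma> \<in> K" "m \<in> carrier N" "\<rho> \<in> K" by auto
    have "act (p \<otimes>\<^bsub>semidirect N K\<^esub> q) = compose (carrier N) (act p) (act q)"
    proof
      fix x
      show "act (p \<otimes>\<^bsub>semidirect N K\<^esub> q) x = compose (carrier N) (act p) (act q) x"
      proof (cases "x \<in> carrier N")
        case True
        then show ?thesis
          using in_carrier by (simp add: pq compose_eq inv_mult_group m_assoc)
      qed (simp add: pq semidirect_action_def compose_def)
    qed
    then show "act (p \<otimes>\<^bsub>semidirect N K\<^esub> q) = act p \<otimes>\<^bsub>BijGroup (carrier N)\<^esub> act q"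
      using in_carrier by (simp add: pq act_Bij compose_in_BijGroup del: mult_semidirect)
  qed
  then show ?thesis
    by (simp add: group_hom_def group_hom_axioms_def group_BijGroup group_semidirect)
qed

text \<open>The image of \<open>\<one>\<close> is \<open>inv n\<close>, so the permutation
  determines \<open>n\<close>, and then it determines \<open>\<sigma>\<close>.\<close>

lemma act_faithful: "faithful_action (semidirect N K) (carrier N) act"
proof -
  have "inj_on act (carrier (semidirect N K))"
  proof (rule inj_onI)
    fix p q assume "p \<in> carrier (semidirect N K)" "q \<in> carrier (semidirect N K)"
    then obtain n \<sigma> m \<rho> where pq: "p = (n, \<sigma>)" "q = (m, \<rho>)"
      and in_carrier: "n \<in> carrier N" "\<sigma> \<in> K" "m \<in> carrier N" "\<rho> \<in> K" by auto
    assume "act p = act q"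
    then have eq: "\<sigma> x \<otimes> inv n = \<rho> x \<otimes> inv m" if "x \<in> carrier N" for x
      using that act_apply by (metis pq)
    have "inv n = inv m" using eq[of \<one>] in_carrier by simp
    then have "n = m" using in_carrier by (metis inv_inv)
    moreover have "\<sigma> = \<rho>"
    proof (rule extensionalityI)
      show "\<sigma> \<in> extensional (carrier N)" "\<rho> \<in> extensional (carrier N)"
        using K_Bij in_carrier by (auto simp: Bij_def)
      show "\<sigma> x = \<rho> x" if "x \<in> carrier N" for x
        using eq[OF that] that in_carrier \<open>n = m\<close> by simp
    qed
    ultimately show "p = q" by (simp add: pq)
  qed
  then show ?thesis
    by (simp add: faithful_action_def faithful_action_axioms_def group_action_def act_hom)
qed

lemma perms_subgroup: "subgroup perms (BijGroup (carrier N))"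
  by (rule group_hom.img_is_subgroup[OF act_hom])

lemma act_in_perms [intro]: "n \<in> carrier N \<Longrightarrow> \<sigma> \<in> K \<Longrightarrow> act (n, \<sigma>) \<in> perms"
  by auto

text \<open>Right multiplication by \<open>inv x \<otimes> y\<close> carries \<open>x\<close> to
  \<open>y\<close>, and it is the action of \<open>(inv y \<otimes> x, idN)\<close>. This serves
  both the whole group and its normal subgroups.\<close>

lemma transitive_if_contains_translations:
  assumes M: "subgroup M (BijGroup (carrier N))"
    and trans: "\<And>n. n \<in> carrier N \<Longrightarrow> act (n, idN) \<in> M"
  shows "transitive_action (perm_group (carrier N) M) (carrier N) (\<lambda>g. g)"
proof -
  interpret group_action "perm_group (carrier N) M" "carrier N" "\<lambda>g. g"
    by (rule perm_group_action[OF M])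
  show ?thesis
  proof
    fix x y assume xy: "x \<in> carrier N" "y \<in> carrier N"
    then have "act (inv y \<otimes> x, idN) x = y"
      by (simp add: inv_mult_group m_assoc[symmetric])
    moreover have "act (inv y \<otimes> x, idN) \<in> carrier (perm_group (carrier N) M)"
      using xy trans by (simp add: perm_group_def)
    ultimately show "\<exists>g \<in> carrier (perm_group (carrier N) M). g x = y" by blast
  qed
qed

text \<open>A normal subgroup \<open>M\<close> that meets \<open>N\<close> trivially commutes with \<open>N\<close>, so that every element
  \<open>(n, \<sigma>)\<close> of \<open>M\<close> has \<open>\<sigma>\<close> equal to an inner automorphism.\<close>

lemma quasiprimitive_perms:
  assumes outer: "\<And>\<sigma> n. \<sigma> \<in> K \<Longrightarrow> \<sigma> \<noteq> idN \<Longrightarrow> n \<in> carrier N \<Longrightarrow>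
      \<exists>k \<in> carrier N. n \<otimes> \<sigma> k \<otimes> inv n \<noteq> k"
    and simple: "\<And>L. L \<lhd> N \<Longrightarrow> (\<And>\<sigma>. \<sigma> \<in> K \<Longrightarrow> \<sigma> ` L \<subseteq> L) \<Longrightarrow> L = {\<one>} \<or> L = carrier N"
  shows "quasiprimitive (carrier N) perms"
  unfolding quasiprimitive_def
proof (intro allI impI)
  fix M assume M: "M \<lhd> perm_group (carrier N) perms"
    and nontriv: "M \<noteq> {\<one>\<^bsub>perm_group (carrier N) perms\<^esub>}"
  interpret act: group_hom "semidirect N K" "BijGroup (carrier N)" act by (rule act_hom)
  have M_sub: "subgroup M (BijGroup (carrier N))"
    using act.H.incl_subgroup[OF perms_subgroup] normal_imp_subgroup[OF M]
    unfolding perm_group_def .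
  have M_perms: "M \<subseteq> perms"
    using subgroup.subset[OF normal_imp_subgroup[OF M]] by (simp add: perm_group_def)
  \<comment> \<open>Here \<open>r\<close> is the conjugate of \<open>q\<close> by \<open>p\<close>;
    the equation is written without inverses so that it can be checked directly in the semidirect
    product.\<close>
  have conj: "act r \<in> M"
    if "p \<in> carrier (semidirect N K)" "q \<in> carrier (semidirect N K)" "r \<in> carrier (semidirect N K)"
      "act q \<in> M" "r \<otimes>\<^bsub>semidirect N K\<^esub> p = p \<otimes>\<^bsub>semidirect N K\<^esub> q" for p q r
  proof -
    have p: "act p \<in> perms" using that(1) by blast
    have "act p \<otimes>\<^bsub>BijGroup (carrier N)\<^esub> act q \<otimes>\<^bsub>BijGroup (carrier N)\<^esub> inv\<^bsub>BijGroup (carrier N)\<^esub> act p \<in> M"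
      using normal.inv_op_closed2[OF M, of "act p" "act q"] p that(4)
        act.H.m_inv_consistent[OF perms_subgroup p] by (simp add: perm_group_def)
    moreover have "act r \<otimes>\<^bsub>BijGroup (carrier N)\<^esub> act p = act p \<otimes>\<^bsub>BijGroup (carrier N)\<^esub> act q"
      using that by (metis act.hom_mult)
    ultimately show ?thesis
      using act.hom_closed[OF that(1)] act.hom_closed[OF that(3)]
      by (metis act.H.inv_solve_right act.H.m_closed)
  qed
  \<comment> \<open>This is the intersection of \<open>M\<close> with \<open>N\<close>, pulled back
    to \<open>N\<close>.\<close>
  define L where "L = {n \<in> carrier N. act (n, idN) \<in> M}"
  \<comment> \<open>Conjugation by \<open>(k, \<sigma>)\<close> gives both properties of
    \<open>L\<close> at once: normality in \<open>N\<close> for \<open>\<sigma> = idN\<close>, and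
    invariance under \<open>K\<close> for \<open>k = \<one>\<close>.\<close>
  have conj_L: "k \<otimes> \<sigma> n \<otimes> inv k \<in> L" if "n \<in> L" "k \<in> carrier N" "\<sigma> \<in> K" for n k \<sigma>
  proof -
    have "n \<in> carrier N" "act (n, idN) \<in> M" using that by (auto simp: L_def)
    then have "act (k \<otimes> \<sigma> n \<otimes> inv k, idN) \<in> M"
      using that conj[of "(k, \<sigma>)" "(n, idN)" "(k \<otimes> \<sigma> n \<otimes> inv k, idN)"]
      by (simp add: m_assoc)
    then show ?thesis using that \<open>n \<in> carrier N\<close> by (simp add: L_def)
  qed
  have "subgroup L N"
  proof (rule subgroupI)
    have "act (\<one>, idN) \<in> M"
      using act.hom_one subgroup.one_closed[OF M_sub] by simp
    then show "L \<noteq> {}" by (auto simp: L_def)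
    show "inv n \<in> L" if "n \<in> L" for n
    proof -
      have n: "n \<in> carrier N" "act (n, idN) \<in> M" using that by (auto simp: L_def)
      then have "inv\<^bsub>semidirect N K\<^esub> (n, idN) = (inv n, idN)"
        by (intro group.inv_equality[OF group_semidirect]) simp_all
      then have "act (inv n, idN) = inv\<^bsub>BijGroup (carrier N)\<^esub> act (n, idN)"
        using act.hom_inv[of "(n, idN)"] n by simp
      then show ?thesis using subgroup.m_inv_closed[OF M_sub] n by (simp add: L_def)
    qed
    show "n \<otimes> m \<in> L" if "n \<in> L" "m \<in> L" for n m
    proof -
      have nm: "n \<in> carrier N" "act (n, idN) \<in> M" "m \<in> carrier N" "act (m, idN) \<in> M"
        using that by (auto simp: L_def)
      then have "act (n \<otimes> m, idN) = act (n, idN) \<otimes>\<^bsub>BijGroup (carrier N)\<^esub> act (m, idN)"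
        using act.hom_mult[of "(n, idN)" "(m, idN)"] by simp
      then show ?thesis using subgroup.m_closed[OF M_sub] nm by (simp add: L_def)
    qed
  qed (auto simp: L_def)
  moreover have "k \<otimes> n \<otimes> inv k \<in> L" if "n \<in> L" "k \<in> carrier N" for n k
    using conj_L[OF that, of idN] that by (simp add: L_def)
  ultimately have "L \<lhd> N" by (simp add: normal_inv_iff)
  moreover have "\<sigma> ` L \<subseteq> L" if "\<sigma> \<in> K" for \<sigma>
    using conj_L[of _ \<one> \<sigma>] that by (auto simp: L_def)
  moreover have "L \<noteq> {\<one>}"
  proof
    assume L: "L = {\<one>}"
    have "act p = \<one>\<^bsub>BijGroup (carrier N)\<^esub>" if p_in: "p \<in> carrier (semidirect N K)" "act p \<in> M" for p
    proof -
      obtain n \<sigma> where p: "p = (n, \<sigma>)" "n \<in> carrier N" "\<sigma> \<in> K" using p_in by auto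
      have "k = n \<otimes> \<sigma> k \<otimes> inv n" if k: "k \<in> carrier N" for k
      proof -
        have conj_p: "act (k \<otimes> n \<otimes> inv (\<sigma> k), \<sigma>) \<in> M"
          using p k p_in conj[of "(k, idN)" p "(k \<otimes> n \<otimes> inv (\<sigma> k), \<sigma>)"]
          by (simp add: m_assoc)
        \<comment> \<open>The commutator of \<open>(k, idN)\<close> and \<open>p\<close> is
          \<open>(?c, idN)\<close>. It acts as an element of \<open>M\<close> and lies in
          \<open>N\<close>, so it is trivial.\<close>
        let ?c = "k \<otimes> n \<otimes> inv (\<sigma> k) \<otimes> inv n"
        have "act (k \<otimes> n \<otimes> inv (\<sigma> k), \<sigma>) = act (?c, idN) \<otimes>\<^bsub>BijGroup (carrier N)\<^esub> act p"
          using act.hom_mult[of "(?c, idN)" p] p k by (simp add: m_assoc)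
        then have "act (?c, idN) = act (k \<otimes> n \<otimes> inv (\<sigma> k), \<sigma>)
            \<otimes>\<^bsub>BijGroup (carrier N)\<^esub> inv\<^bsub>BijGroup (carrier N)\<^esub> act p"
          using act.hom_closed[of "(?c, idN)"] act.hom_closed[OF p_in(1)] p k
          by (simp add: act.H.m_assoc)
        then have "act (?c, idN) \<in> M"
          using conj_p subgroup.m_closed[OF M_sub] subgroup.m_inv_closed[OF M_sub p_in(2)] by simp
        then have "?c \<in> L" using p k by (simp add: L_def)
        then have "?c = \<one>" by (simp only: L singleton_iff)
        then have "k \<otimes> (n \<otimes> inv (\<sigma> k) \<otimes> inv n) = \<one>" using p k by (simp add: m_assoc)
        then have "inv (n \<otimes> inv (\<sigma> k) \<otimes> inv n) = k"
          using p k by (intro inv_equality) simp_all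
        moreover have "inv (n \<otimes> inv (\<sigma> k) \<otimes> inv n) = n \<otimes> \<sigma> k \<otimes> inv n"
          using p k by (simp add: inv_mult_group m_assoc)
        ultimately show ?thesis by simp
      qed
      \<comment> \<open>The equation for all \<open>k\<close> says that \<open>\<sigma>\<close> is
        conjugation by \<open>inv n\<close>, which \<open>outer\<close> permits only for the
        identity.\<close>
      then have "\<sigma> = idN" using outer[OF p(3) _ p(2)] by force
      then have "n \<in> L" using p p_in by (simp add: L_def)
      then have "p = \<one>\<^bsub>semidirect N K\<^esub>" using L p \<open>\<sigma> = idN\<close> by simp
      then show ?thesis using act.hom_one by simp
    qed
    then have "M \<subseteq> {\<one>\<^bsub>BijGroup (carrier N)\<^esub>}" using M_perms by blast
    then show False
      using nontriv subgroup.one_closed[OF M_sub] by (auto simp: perm_group_def)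
  qed
  ultimately have "L = carrier N" using simple by blast
  then show "transitive_action (perm_group (carrier N) M) (carrier N) (\<lambda>g. g)"
    by (intro transitive_if_contains_translations[OF M_sub]) (auto simp: L_def)
qed

end

section \<open>Oriented Cayley graphs of valency four\<close>

text \<open>An arc \<open>(x, y)\<close> is directed by its quotient
  \<open>y \<otimes> inv x\<close>. Right translations preserve quotients, and \<open>K\<close>
  permutes \<open>S0\<close> transitively, so the directed arcs form one orbit; this yields both
  edge transitivity and the orientation.\<close>

lemma (in automorphism_subgroup) cayley_graph_OG4:
  assumes fin: "finite (carrier N)" and S0: "S0 \<subseteq> carrier N" and card: "card S0 = 2"
    and disj: "S0 \<inter> (\<lambda>s. inv s) ` S0 = {}"
    and gen: "generate N S0 = carrier N"
    and K_S0: "\<And>\<sigma>. \<sigma> \<in> K \<Longrightarrow> \<sigma> ` S0 = S0"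
    and trans: "\<And>s t. s \<in> S0 \<Longrightarrow> t \<in> S0 \<Longrightarrow> \<exists>\<sigma> \<in> K. \<sigma> s = t"
  shows "(cayley_graph N (S0 \<union> (\<lambda>s. inv s) ` S0), perms) \<in> OG4"
proof -
  define S where "S = S0 \<union> (\<lambda>s. inv s) ` S0"
  define \<Gamma> where "\<Gamma> = cayley_graph N S"
  define \<Delta> where "\<Delta> = {(x, y). x \<in> carrier N \<and> y \<in> carrier N \<and> y \<otimes> inv x \<in> S0}"
  have verts: "pverts \<Gamma> = carrier N" by (simp add: \<Gamma>_def cayley_graph_def)
  have S: "S \<subseteq> carrier N" using S0 by (auto simp: S_def)
  have S_inv: "(\<lambda>s. inv s) ` S \<subseteq> S" using S0 by (auto simp: S_def)
  \<comment> \<open>The identity is its own inverse, so disjointness excludes it.\<close>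
  have "\<one> \<notin> S0" using disj by (metis IntI emptyE imageI inv_one)
  then have one: "\<one> \<notin> S" using S0 by (auto simp: S_def) (metis inv_eq_1_iff subsetD)
  have "finite S0" using card by (metis card.infinite zero_neq_numeral)
  moreover have "card ((\<lambda>s. inv s) ` S0) = 2"
    using card inj_on_subset[OF inv_inj S0] by (simp add: card_image)
  ultimately have card_S: "card S = 4"
    using disj card by (simp add: S_def card_Un_disjoint)
  have gen_S: "generate N S = carrier N"
    using mono_generate[of S0 S] generate_incl[OF S] gen by (auto simp: S_def)
  have arcs: "parcs \<Gamma> = \<Delta> \<union> \<Delta>\<inverse>"
  proof -
    have "x \<otimes> inv y \<in> S \<longleftrightarrow> y \<otimes> inv x \<in> S0 \<or> x \<otimes> inv y \<in> S0"
      if "x \<in> carrier N" "y \<in> carrier N" for x y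
    proof -
      have "inv (y \<otimes> inv x) = x \<otimes> inv y" using that by (simp add: inv_mult_group)
      moreover have "y \<otimes> inv x \<in> S0" if "x \<otimes> inv y = inv s" "s \<in> S0" for s
      proof -
        have "y \<otimes> inv x = inv (inv s)"
          using \<open>x \<in> carrier N\<close> \<open>y \<in> carrier N\<close> that(1)[symmetric] by (simp add: inv_mult_group)
        then show ?thesis using that S0 by auto
      qed
      ultimately show ?thesis unfolding S_def by (auto simp: image_iff) metis
    qed
    then show ?thesis by (auto simp: \<Gamma>_def \<Delta>_def cayley_graph_def)
  qed
  have arcs_sub: "parcs \<Gamma> \<subseteq> pverts \<Gamma> \<times> pverts \<Gamma>" by (auto simp: \<Gamma>_def cayley_graph_def)
  have \<Delta>_disj: "\<Delta> \<inter> \<Delta>\<inverse> = {}"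
  proof -
    have "\<not> (y \<otimes> inv x \<in> S0 \<and> x \<otimes> inv y \<in> S0)" if "x \<in> carrier N" "y \<in> carrier N" for x y
    proof
      assume "y \<otimes> inv x \<in> S0 \<and> x \<otimes> inv y \<in> S0"
      moreover have "inv (y \<otimes> inv x) = x \<otimes> inv y" using that by (simp add: inv_mult_group)
      ultimately have "x \<otimes> inv y \<in> S0 \<inter> (\<lambda>s. inv s) ` S0" by force
      then show False using disj by simp
    qed
    then show ?thesis by (auto simp: \<Delta>_def)
  qed
  \<comment> \<open>The right factor \<open>inv n\<close> cancels, leaving only the
    automorphism.\<close>
  have act_quotient: "act (n, \<sigma>) y \<otimes> inv (act (n, \<sigma>) x) = \<sigma> (y \<otimes> inv x)"
    if "n \<in> carrier N" "\<sigma> \<in> K" "x \<in> carrier N" "y \<in> carrier N" for n \<sigma> x y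
    using that by (simp add: inv_mult_group m_assoc) (simp add: m_assoc[symmetric])
  have K_S0_iff: "\<sigma> z \<in> S0 \<longleftrightarrow> z \<in> S0" if "\<sigma> \<in> K" "z \<in> carrier N" for \<sigma> z
    using K_S0[OF that(1)] K_inj[OF that(1)] that(2) S0 by (metis imageE imageI subsetD)
  have perms_\<Delta>: "(g x, g y) \<in> \<Delta> \<longleftrightarrow> (x, y) \<in> \<Delta>"
    if "g \<in> perms" "x \<in> carrier N" "y \<in> carrier N" for g x y
  proof -
    obtain n \<sigma> where g: "g = act (n, \<sigma>)" "n \<in> carrier N" "\<sigma> \<in> K" using \<open>g \<in> perms\<close> by auto
    have "g x \<in> carrier N" "g y \<in> carrier N" using g that by simp_all
    moreover have "g y \<otimes> inv (g x) = \<sigma> (y \<otimes> inv x)"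
      unfolding g(1) using act_quotient g that by blast
    moreover have "\<sigma> (y \<otimes> inv x) \<in> S0 \<longleftrightarrow> y \<otimes> inv x \<in> S0"
      by (rule K_S0_iff) (use g that in simp_all)
    ultimately show ?thesis using that by (simp only: \<Delta>_def mem_Collect_eq case_prod_conv)
  qed
  have \<Delta>_trans: "\<exists>g \<in> perms. g x = x' \<and> g y = y'" if "(x, y) \<in> \<Delta>" "(x', y') \<in> \<Delta>" for x y x' y'
  proof -
    have in_carrier: "x \<in> carrier N" "y \<in> carrier N" "x' \<in> carrier N" "y' \<in> carrier N"
      and quotients: "y \<otimes> inv x \<in> S0" "y' \<otimes> inv x' \<in> S0" using that by (auto simp: \<Delta>_def)
    obtain \<sigma> where \<sigma>: "\<sigma> \<in> K" "\<sigma> (y \<otimes> inv x) = y' \<otimes> inv x'" using trans[OF quotients] by blast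
    \<comment> \<open>The automorphism matches the quotients; the translation part is then forced by
      \<open>x \<mapsto> x'\<close>, and cancellation gives \<open>y \<mapsto> y'\<close>.\<close>
    let ?g = "act (inv x' \<otimes> \<sigma> x, \<sigma>)"
    have "?g x = x'"
      using in_carrier \<sigma>(1) by (simp add: inv_mult_group m_assoc[symmetric])
    moreover have "?g y \<otimes> inv (?g x) = y' \<otimes> inv x'"
      using act_quotient in_carrier \<sigma> by simp
    ultimately have "?g y = y'"
      using in_carrier \<sigma>(1) \<open>?g x = x'\<close> by (metis K_closed act_apply inv_closed m_closed right_cancel)
    with \<open>?g x = x'\<close> show ?thesis using in_carrier \<sigma>(1) by (intro bexI[of _ ?g]) auto
  qed
  have perms_closed: "g x \<in> carrier N" if "g \<in> perms" "x \<in> carrier N" for g x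
    using subgroup_BijGroup_imp_Bij[OF perms_subgroup that(1)] Bij_imp_funcset that(2) by blast
  have auts: "perms \<subseteq> graph_auto \<Gamma>"
  proof
    fix g assume g: "g \<in> perms"
    show "g \<in> graph_auto \<Gamma>"
      using perms_\<Delta>[OF g] subgroup_BijGroup_imp_Bij[OF perms_subgroup g]
      by (simp add: graph_auto_def arcs verts)
  qed
  have carrier_perm: "carrier (perm_group (pverts \<Gamma>) perms) = perms"
    by (simp add: perm_group_def)
  have "pair_graph \<Gamma>" unfolding \<Gamma>_def by (rule pair_graph_cayley_graph[OF fin S_inv one])
  moreover have "connected (with_proj \<Gamma>)"
    unfolding \<Gamma>_def by (rule connected_cayley_graph[OF fin S S_inv one gen_S])
  moreover have "\<forall>x \<in> pverts \<Gamma>. out_degree (with_proj \<Gamma>) x = 4"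
    using out_degree_cayley_graph[OF S] card_S by (simp add: verts \<Gamma>_def[symmetric])
  moreover have "subgroup perms (graph_AutoGroup \<Gamma>)"
    unfolding graph_AutoGroup_def
    using group.subgroup_incl[OF group_BijGroup] perms_subgroup subgroup_graph_auto auts
    by (metis verts)
  moreover have "transitive_action (perm_group (pverts \<Gamma>) perms) (pverts \<Gamma>) (\<lambda>g. g)"
    unfolding verts by (rule transitive_if_contains_translations[OF perms_subgroup]) auto
  moreover have "transitive_action (perm_group (pverts \<Gamma>) perms) (edges \<Gamma>)
      (\<lambda>g. \<lambda>e \<in> edges \<Gamma>. g ` e)"
  proof -
    \<comment> \<open>Naming the ends of each edge along its direction reduces edge transitivity to
      transitivity on \<open>\<Delta>\<close>.\<close>
    have edge: "\<exists>x y. e = {x, y} \<and> (x, y) \<in> \<Delta>" if "e \<in> edges \<Gamma>" for e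
      using that by (auto simp: edges_def arcs)
    have "\<exists>g \<in> perms. g ` e = e'" if e: "e \<in> edges \<Gamma>" and e': "e' \<in> edges \<Gamma>" for e e'
    proof -
      obtain x y where xy: "e = {x, y}" "(x, y) \<in> \<Delta>" using edge[OF e] by blast
      obtain x' y' where xy': "e' = {x', y'}" "(x', y') \<in> \<Delta>" using edge[OF e'] by blast
      obtain g where g: "g \<in> perms" "g x = x'" "g y = y'" using \<Delta>_trans[OF xy(2) xy'(2)] by blast
      have "g ` e = e'" by (simp add: xy xy' g)
      then show ?thesis using g(1) by (rule bexI)
    qed
    moreover have "group_action (perm_group (pverts \<Gamma>) perms) (edges \<Gamma>) (\<lambda>g. \<lambda>e \<in> edges \<Gamma>. g ` e)"
      using edge_action[OF arcs_sub _ auts] perms_subgroup by (simp only: verts)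
    ultimately show ?thesis
      unfolding transitive_action_def transitive_action_axioms_def carrier_perm by simp
  qed
  moreover have "G_oriented \<Gamma> perms"
  proof -
    obtain s where s: "s \<in> S0" using card by fastforce
    then have s_\<Delta>: "(\<one>, s) \<in> \<Delta>" using S0 by (auto simp: \<Delta>_def)
    have "orbit (perm_group (pverts \<Gamma>) perms) (\<lambda>g. map_prod g g) (\<one>, s) = \<Delta>"
    proof
      show "orbit (perm_group (pverts \<Gamma>) perms) (\<lambda>g. map_prod g g) (\<one>, s) \<subseteq> \<Delta>"
      proof
        fix p assume "p \<in> orbit (perm_group (pverts \<Gamma>) perms) (\<lambda>g. map_prod g g) (\<one>, s)"
        then obtain g where "g \<in> perms" "p = (g \<one>, g s)"
          unfolding orbit_def carrier_perm by auto
        then show "p \<in> \<Delta>" using perms_\<Delta>[of g \<one> s] s_\<Delta> S0 s by blast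
      qed
      show "\<Delta> \<subseteq> orbit (perm_group (pverts \<Gamma>) perms) (\<lambda>g. map_prod g g) (\<one>, s)"
      proof
        fix p assume "p \<in> \<Delta>"
        then obtain g where "g \<in> perms" "p = (g \<one>, g s)" using \<Delta>_trans[OF s_\<Delta>] by (cases p) blast
        then show "p \<in> orbit (perm_group (pverts \<Gamma>) perms) (\<lambda>g. map_prod g g) (\<one>, s)"
          unfolding orbit_def carrier_perm by auto
      qed
    qed
    then have "\<Delta> \<in> orbits (perm_group (pverts \<Gamma>) perms) (pverts \<Gamma> \<times> pverts \<Gamma>) (\<lambda>g. map_prod g g)"
      unfolding orbits_def using s S0 by (force simp: verts)
    then show ?thesis unfolding G_oriented_def using \<Delta>_disj arcs by blast
  qed
  ultimately have "(\<Gamma>, perms) \<in> OG4" by (simp add: OG4_def)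
  then show ?thesis by (simp add: \<Gamma>_def S_def)
qed

section \<open>The coordinate swap\<close>

lemma (in group) swap_in_auto_DirProd:
  "(\<lambda>(x, y) \<in> carrier (G \<times>\<times> G). (y, x)) \<in> auto (G \<times>\<times> G)"
proof -
  have "bij_betw (\<lambda>(x, y). (y, x)) (carrier (G \<times>\<times> G)) (carrier (G \<times>\<times> G))"
    by (rule bij_betw_byWitness[where f' = "\<lambda>(x, y). (y, x)"]) auto
  then have "bij_betw (\<lambda>(x, y). (y, x)) (carrier G \<times> carrier G) (carrier G \<times> carrier G)" by simp
  then show ?thesis
    by (auto simp: auto_def Bij_def hom_def cong: bij_betw_cong)
qed

text \<open>The swap is its own inverse, so closure adds only the identity.\<close>

lemma (in group) generate_swap_DirProd:
  assumes \<tau>_def: "\<tau> = (\<lambda>(x, y) \<in> carrier (G \<times>\<times> G). (y, x))"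
  shows "generate (AutoGroup (G \<times>\<times> G)) {\<tau>} = {\<one>\<^bsub>AutoGroup (G \<times>\<times> G)\<^esub>, \<tau>}"
proof -
  interpret GG: group "G \<times>\<times> G" by (intro DirProd_group) (rule group_axioms)+
  interpret A: group "AutoGroup (G \<times>\<times> G)" by (rule GG.AutoGroup)
  have \<tau>: "\<tau> \<in> carrier (AutoGroup (G \<times>\<times> G))"
    unfolding \<tau>_def AutoGroup_def using swap_in_auto_DirProd by simp
  then have "\<tau> \<in> Bij (carrier (G \<times>\<times> G))" by (simp add: AutoGroup_def auto_def)
  then have \<tau>\<tau>: "\<tau> \<otimes>\<^bsub>AutoGroup (G \<times>\<times> G)\<^esub> \<tau> = \<one>\<^bsub>AutoGroup (G \<times>\<times> G)\<^esub>"
    by (auto simp: AutoGroup_def BijGroup_def compose_def \<tau>_def intro!: restrict_ext)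
  then have inv_\<tau>: "inv\<^bsub>AutoGroup (G \<times>\<times> G)\<^esub> \<tau> = \<tau>" using \<tau> by (intro A.inv_equality)
  have "\<sigma> \<in> {\<one>\<^bsub>AutoGroup (G \<times>\<times> G)\<^esub>, \<tau>}" if "\<sigma> \<in> generate (AutoGroup (G \<times>\<times> G)) {\<tau>}" for \<sigma>
    using that by (induction rule: generate.induct) (use \<tau> \<tau>\<tau> inv_\<tau> in auto)
  then show ?thesis by (auto intro: generate.one generate.incl)
qed

text \<open>If a pair is its own inverse, then \<open>inv a = a\<close> and
  \<open>inv b = b\<close>; if the two pairs are mutually inverse, then \<open>inv a = b\<close>, so
  \<open>a\<close> is central and both generators are trivial. Either case contradicts
  \<open>a \<noteq> b\<close>.\<close>

lemma (in simple_group) swapped_pairs_not_inverse: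
  assumes nc: "\<not> comm_group G" and ab: "a \<in> carrier G" "b \<in> carrier G"
    and gen: "generate G {a, b} = carrier G" and neq: "a \<noteq> b"
  shows "{(a, b), (b, a)} \<inter> (\<lambda>s. inv\<^bsub>G \<times>\<times> G\<^esub> s) ` {(a, b), (b, a)} = {}"
proof -
  have "\<not> (inv a = a \<and> inv b = b)"
    using no_two_involution_generators[OF nc ab gen] neq by blast
  moreover have "inv a \<noteq> b"
  proof
    assume "inv a = b"
    then have "a \<otimes> b = b \<otimes> a" using ab by auto
    then have "a = \<one>"
      by (intro one_if_commutes_with_generators[OF nc gen]) (use ab in auto)
    then show False using \<open>inv a = b\<close> neq by simp
  qed
  ultimately show ?thesis using ab by (auto simp: group_axioms)
qed

text \<open>\<open>OG4\<close> and quasiprimitivity speak of sets of permutations, so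
  \<open>G\<close> enters through the image of its action; faithfulness identifies \<open>G\<close>
  with that image.\<close>

theorem lemma4p8:
  fixes T :: "('t, 'm) monoid_scheme" and a b :: 't
    and N :: "('t \<times> 't) monoid" and S0 S :: "('t \<times> 't) set"
    and \<Gamma> :: "('t \<times> 't) pair_pre_digraph"
    and \<tau> :: "'t \<times> 't \<Rightarrow> 't \<times> 't"
    and G :: "(('t \<times> 't) \<times> ('t \<times> 't \<Rightarrow> 't \<times> 't)) monoid"
  assumes "simple_group T" and "finite (carrier T)" and "\<not> comm_group T"
    and "a \<in> carrier T" and "b \<in> carrier T" and "generate T {a, b} = carrier T"
    and "\<not> (\<exists>\<phi> \<in> auto T. \<phi> a = b \<and> \<phi> b = a)"
    and "N = T \<times>\<times> T"
    and "S0 = {(a, b), (b, a)}" and "S = S0 \<union> (\<lambda>s. inv\<^bsub>N\<^esub> s) ` S0"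
    and "\<Gamma> = cayley_graph N S"
    and "\<tau> = (\<lambda>(x, y) \<in> carrier N. (y, x))"
    and "G = semidirect N (generate (AutoGroup N) {\<tau>})"
  shows "faithful_action G (carrier N) (semidirect_action N)
    \<and> (\<Gamma>, semidirect_action N ` carrier G) \<in> OG4
    \<and> basic_quasiprimitive \<Gamma> (semidirect_action N ` carrier G)"
proof -
  interpret T: simple_group T by fact
  note ab = \<open>a \<in> carrier T\<close> \<open>b \<in> carrier T\<close>
  interpret N: group N unfolding \<open>N = T \<times>\<times> T\<close> by (intro DirProd_group) (rule T.group_axioms)+
  define K where "K = generate (AutoGroup N) {\<tau>}"
  have \<tau>_auto: "\<tau> \<in> auto N"
    using T.swap_in_auto_DirProd by (simp only: \<open>\<tau> = _\<close> \<open>N = _\<close>)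
  have "subgroup K (AutoGroup N)"
    unfolding K_def using \<tau>_auto
    by (intro group.generate_is_subgroup N.AutoGroup) (simp add: AutoGroup_def)
  then interpret automorphism_subgroup N K
    by (simp add: automorphism_subgroup_def automorphism_subgroup_axioms_def N.group_axioms)
  have K_eq: "K = {idN, \<tau>}"
    using T.generate_swap_DirProd[OF refl] by (simp only: K_def \<open>\<tau> = _\<close> \<open>N = _\<close>)
  have \<tau>_apply: "\<tau> (x, y) = (y, x)" if "x \<in> carrier T" "y \<in> carrier T" for x y
    using that by (simp add: \<open>\<tau> = _\<close> \<open>N = _\<close>)
  \<comment> \<open>If \<open>a\<close> and \<open>b\<close> were equal, the identity automorphism
    would interchange them.\<close>
  have neq: "a \<noteq> b"
    using \<open>\<not> (\<exists>\<phi> \<in> auto T. \<phi> a = b \<and> \<phi> b = a)\<close> T.id_in_auto ab by fastforce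
  have OG4: "(\<Gamma>, perms) \<in> OG4"
    unfolding \<open>\<Gamma> = _\<close> \<open>S = _\<close>
  proof (rule cayley_graph_OG4)
    show "finite (carrier N)" using \<open>finite (carrier T)\<close> by (simp add: \<open>N = _\<close>)
    show "S0 \<subseteq> carrier N" using ab by (simp add: \<open>N = _\<close> \<open>S0 = _\<close>)
    show "card S0 = 2" using neq by (simp add: \<open>S0 = _\<close>)
    show "S0 \<inter> (\<lambda>s. inv\<^bsub>N\<^esub> s) ` S0 = {}"
      unfolding \<open>S0 = _\<close> \<open>N = _\<close>
      by (rule T.swapped_pairs_not_inverse[OF \<open>\<not> comm_group T\<close> ab \<open>generate T {a, b} = carrier T\<close> neq])
    show "generate N S0 = carrier N"
      unfolding \<open>S0 = _\<close> \<open>N = _\<close> using assms by (intro T.generate_swapped_pair)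
    show "\<sigma> ` S0 = S0" if "\<sigma> \<in> K" for \<sigma>
      using that ab by (auto simp: K_eq \<open>S0 = _\<close> \<tau>_apply idN_eq) (auto simp: \<open>N = _\<close>)
    show "\<exists>\<sigma> \<in> K. \<sigma> s = t" if "s \<in> S0" "t \<in> S0" for s t
      using that ab by (auto simp: K_eq \<open>S0 = _\<close> \<tau>_apply idN_eq) (auto simp: \<open>N = _\<close>)
  qed
  have "quasiprimitive (carrier N) perms"
  proof (rule quasiprimitive_perms)
    fix \<sigma> n assume "\<sigma> \<in> K" "\<sigma> \<noteq> idN" and n: "n \<in> carrier N"
    then have "\<sigma> = \<tau>" by (simp add: K_eq)
    obtain t where t: "t \<in> carrier T" "t \<noteq> \<one>\<^bsub>T\<^esub>" using T.simple_not_triv T.one_closed by blast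
    obtain u v where uv: "n = (u, v)" "u \<in> carrier T" "v \<in> carrier T"
      using n by (auto simp: \<open>N = _\<close>)
    \<comment> \<open>Inner automorphisms preserve each factor while the swap exchanges them, so a
      nontrivial element of the first factor is not fixed.\<close>
    have "n \<otimes>\<^bsub>N\<^esub> \<sigma> (t, \<one>\<^bsub>T\<^esub>) \<otimes>\<^bsub>N\<^esub> inv\<^bsub>N\<^esub> n = (\<one>\<^bsub>T\<^esub>, v \<otimes>\<^bsub>T\<^esub> t \<otimes>\<^bsub>T\<^esub> inv\<^bsub>T\<^esub> v)"
      using t uv by (simp add: \<open>\<sigma> = \<tau>\<close> \<tau>_apply) (simp add: \<open>N = _\<close> T.group_axioms)
    then show "\<exists>k \<in> carrier N. n \<otimes>\<^bsub>N\<^esub> \<sigma> k \<otimes>\<^bsub>N\<^esub> inv\<^bsub>N\<^esub> n \<noteq> k"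
      using t by (intro bexI[of _ "(t, \<one>\<^bsub>T\<^esub>)"]) (auto simp: \<open>N = _\<close>)
  next
    fix L assume L: "L \<lhd> N" and inv: "\<And>\<sigma>. \<sigma> \<in> K \<Longrightarrow> \<sigma> ` L \<subseteq> L"
    have "(y, x) \<in> L" if "(x, y) \<in> L" for x y
    proof -
      have "(x, y) \<in> carrier N"
        using subgroup.subset[OF normal_imp_subgroup[OF L]] that by blast
      then have "\<tau> (x, y) = (y, x)" by (intro \<tau>_apply) (auto simp: \<open>N = _\<close>)
      then show ?thesis using inv[of \<tau>] that by (force simp: K_eq)
    qed
    then show "L = {\<one>\<^bsub>N\<^esub>} \<or> L = carrier N"
      using T.swap_invariant_normal_subgroup_square[OF \<open>\<not> comm_group T\<close>] L
      unfolding \<open>N = _\<close> by blast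
  qed
  then have "basic_quasiprimitive \<Gamma> perms"
    using OG4 by (simp add: basic_quasiprimitive_def \<open>\<Gamma> = _\<close> cayley_graph_def)
  then show ?thesis
    using OG4 act_faithful by (simp add: \<open>G = _\<close> K_def)
qed

end
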